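(* Let $0<\alpha<1$. Let $\beta$ be a (variable) coefficient with $\beta(x)\ge\beta_0>0$ for some constant $\beta_0$, continuous on $(0,\alpha)$ and on $(\alpha,1)$, and allowed to have a finite jump discontinuity at $\alpha$, with one-sided limits $\beta^\pm=\lim_{x\to\alpha^\pm}\beta(x)$. Let $\sigma,f\in C[0,1]$ with $\sigma\ge 0$, and let $v,w\in\mathbb{R}$. Let $u$ be the solution, with prescribed Dirichlet boundary values $u(0)$ and $u(1)$, of $$(\beta(x)u_x)_x-\sigma(x)u=f(x)+v\,\delta(x-\alpha)+w\,\delta'(x-\alpha),\qquad 0<x<1,$$ or equivalently of the interface problem $$(\beta(x)u_x)_x-\sigma(x)u=f(x)\quad\text{for } x\in(0,\alpha)\cup(\alpha,1),\qquad [u]_\alpha=\frac{2w}{\beta^-+\beta^+},\qquad [\beta u_x]_\alpha=v,$$ with the same boundary values. Assume that $u$ is piecewise $C^4$ excluding the interface $\alpha$, i.e. the restrictions of $u$ to $(0,\alpha)$ and $(\alpha,1)$ extend to $C^4$ functions on $[0,\alpha]$ and $[\alpha,1]$ respectively. For $N$ large, let $h=1/N$, $x_i=ih$, and let $\mathbf{U}=(U_i)$ be the finite difference solution computed by the improved harmonic average method (defined in the context) on this grid. Let $\mathbf{E}$ be the error vector with components $E_i=u(x_i)-U_i$, $1\le i\le N-1$. Then the method converges with second order in the infinity norm: there is a constant $C$, independent of $h$, such that for all sufficiently large $N$, $$\|\mathbf{E}\|_\infty=\max_{1\le i\le N-1}|E_i|\le C h^2 .$$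
   Context: Jump notation: $[g]_\alpha=\lim_{x\to\alpha^+}g(x)-\lim_{x\to\alpha^-}g(x)$, and $\beta^\pm=\lim_{x\to\alpha^\pm}\beta(x)$. The Dirac terms in the first form of the equation are understood through the equivalent interface problem written in the claim. Grid: $N$ is a positive integer, $h=1/N$, $x_i=ih$ for $0\le i\le N$, $x_{i+\frac12}=x_i+\frac h2$, $f_i=f(x_i)$, $\sigma_i=\sigma(x_i)$, $\beta_{i+\frac12}=\beta(x_{i+\frac12})$. The index $j$ (depending on $N$) is defined by $x_j\le\alpha<x_{j+1}$; $N$ is taken large enough that $1\le j$ and $j+1\le N-1$. The points $x_j,x_{j+1}$ are called irregular grid points; all other interior grid points are regular. If $\alpha=x_j$, then $u(x_j)$ means the left limit $\lim_{x\to\alpha^-}u(x)$. Improved harmonic average method: $U_0=u(0)$, $U_N=u(1)$ are the prescribed boundary values, and $U_1,\dots,U_{N-1}$ solve the following linear system. At regular grid points ($1\le i\le N-1$, $i\ne j,j+1$): $$\frac1{h^2}\Big(\beta_{i+\frac12}(U_{i+1}-U_i)-\beta_{i-\frac12}(U_i-U_{i-1})\Big)-\sigma_iU_i=f_i .$$ At the irregular grid points: $$\frac1{h_l}\left(\frac{\bar\beta_{j+\frac12}(U_{j+1}-U_j)}{h}-\frac{\beta_{j-\frac12}(U_j-U_{j-1})}{h}\right)-\sigma_jU_j=f_j+C_j,$$ $$\frac1{h_r}\left(\frac{\beta_{j+\frac32}(U_{j+2}-U_{j+1})}{h}-\frac{\bar\beta_{j+\frac12}(U_{j+1}-U_j)}{h}\right)-\sigma_{j+1}U_{j+1}=f_{j+1}+C_{j+1},$$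 where $h_l=\alpha-x_{j-\frac12}>0$, $h_r=x_{j+\frac32}-\alpha>0$, and $$\bar\beta_{j+\frac12}=\left(\frac{x_{j+1}-\alpha}{\beta^+h}+\frac{\alpha-x_j}{\beta^-h}\right)^{-1},$$ $$C_j=\frac{\bar\beta_{j+\frac12}}{h_l\,h}\left([u]_\alpha+\frac{[\beta u_x]_\alpha}{\beta^+}(x_{j+1}-\alpha)\right),\qquad C_{j+1}=-\frac{\bar\beta_{j+\frac12}}{h_r\,h}\left([u]_\alpha+\frac{[\beta u_x]_\alpha}{\beta^-}(x_j-\alpha)\right),$$ with $[u]_\alpha=\frac{2w}{\beta^-+\beta^+}$ and $[\beta u_x]_\alpha=v$.
   Formalization: Added hypothesis: the flux βu_x is piecewise C^3 up to α and the boundary (automatic if β is piecewise C^3); without it the claim fails, e.g. α=1/2, σ=v=w=0, u=x, f=Σ2^{-k}cos(2π3^k x), β=2+∫_0^x f. *)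

theory Defs
  imports "HOL-Analysis.Analysis"
begin

text \<open>At the end points of an interval the derivatives are one-sided.\<close>

definition Ck_on :: "nat \<Rightarrow> real set \<Rightarrow> (real \<Rightarrow> real) \<Rightarrow> bool" where
  "Ck_on k S g \<longleftrightarrow>
     (\<exists>D :: nat \<Rightarrow> real \<Rightarrow> real.
        (\<forall>x\<in>S. D 0 x = g x) \<and>
        (\<forall>m<k. \<forall>x\<in>S. (D m has_real_derivative D (Suc m) x) (at x within S)) \<and>
        continuous_on S (D k))"

definition piecewise_Ck :: "nat \<Rightarrow> real \<Rightarrow> (real \<Rightarrow> real) \<Rightarrow> bool" where
  "piecewise_Ck k \<alpha> g \<longleftrightarrow>
     (\<exists>gl. Ck_on k {0..\<alpha>} gl \<and> (\<forall>x\<in>{0<..<\<alpha>}. gl x = g x)) \<and>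
     (\<exists>gr. Ck_on k {\<alpha>..1} gr \<and> (\<forall>x\<in>{\<alpha><..<1}. gr x = g x))"

text \<open>The jump is a relation rather than a difference of \<^const>\<open>Lim\<close> terms, so that
  it entails the existence of both one-sided limits.\<close>

definition has_jump :: "(real \<Rightarrow> real) \<Rightarrow> real \<Rightarrow> real \<Rightarrow> bool" where
  "has_jump g \<alpha> J \<longleftrightarrow>
     (\<exists>l r. (g \<longlongrightarrow> l) (at_left \<alpha>) \<and> (g \<longlongrightarrow> r) (at_right \<alpha>) \<and> J = r - l)"

text \<open>Continuity of \<open>f\<close> and \<open>\<sigma>\<close> and a piecewise \<open>C^4\<close> solution do not
  suffice for second order: with \<open>u x = x\<close> and \<open>\<beta>\<close> a primitive of a Weierstrass-type
  \<open>f\<close>, the scheme converges more slowly.  Hence the flux is also required to be piecewise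
  \<open>C^3\<close>, as it is when \<open>\<beta>\<close> is piecewise \<open>C^3\<close> and \<open>u\<close> piecewise \<open>C^4\<close>.\<close>

definition flux :: "(real \<Rightarrow> real) \<Rightarrow> (real \<Rightarrow> real) \<Rightarrow> real \<Rightarrow> real" where
  "flux \<beta> u x = \<beta> x * deriv u x"

text \<open>The interface problem; \<open>\<beta>m\<close> and \<open>\<beta>p\<close> are the left and right limits of \<open>\<beta>\<close> at
  \<open>\<alpha>\<close>.  The first two conjuncts say that the boundary values \<open>u 0\<close> and \<open>u 1\<close> are attained
  continuously.  The value of \<open>u\<close> at \<open>\<alpha>\<close> itself is unconstrained.\<close>

definition interface_solution ::
  "real \<Rightarrow> (real \<Rightarrow> real) \<Rightarrow> real \<Rightarrow> real \<Rightarrow> (real \<Rightarrow> real) \<Rightarrow> (real \<Rightarrow> real) \<Rightarrow> real \<Rightarrow> real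
     \<Rightarrow> (real \<Rightarrow> real) \<Rightarrow> bool" where
  "interface_solution \<alpha> \<beta> \<beta>m \<beta>p \<sigma> f v w u \<longleftrightarrow>
     (u \<longlongrightarrow> u 0) (at_right 0) \<and>
     (u \<longlongrightarrow> u 1) (at_left 1) \<and>
     (\<forall>x\<in>{0<..<\<alpha>} \<union> {\<alpha><..<1}.
        u differentiable (at x) \<and>
        flux \<beta> u differentiable (at x) \<and>
        deriv (flux \<beta> u) x - \<sigma> x * u x = f x) \<and>
     has_jump u \<alpha> (2 * w / (\<beta>m + \<beta>p)) \<and>
     has_jump (flux \<beta> u) \<alpha> v"

definition mesh :: "nat \<Rightarrow> real" where
  "mesh N = 1 / real N"

definition grid :: "nat \<Rightarrow> nat \<Rightarrow> real" where
  "grid N i = real i * mesh N"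

text \<open>\<open>midpt N i\<close> is $x_{i+1/2}$, so $x_{i-1/2}$ is \<open>midpt N (i - 1)\<close> for \<open>i \<ge> 1\<close>.\<close>

definition midpt :: "nat \<Rightarrow> nat \<Rightarrow> real" where
  "midpt N i = grid N i + mesh N / 2"

definition left_irregular :: "real \<Rightarrow> nat \<Rightarrow> nat \<Rightarrow> bool" where
  "left_irregular \<alpha> N j \<longleftrightarrow> grid N j \<le> \<alpha> \<and> \<alpha> < grid N (j + 1)"

definition beta_bar :: "real \<Rightarrow> real \<Rightarrow> real \<Rightarrow> nat \<Rightarrow> nat \<Rightarrow> real" where
  "beta_bar \<alpha> \<beta>m \<beta>p N j =
     inverse ((grid N (j + 1) - \<alpha>) / (\<beta>p * mesh N) + (\<alpha> - grid N j) / (\<beta>m * mesh N))"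

definition width_l :: "real \<Rightarrow> nat \<Rightarrow> nat \<Rightarrow> real" where
  "width_l \<alpha> N j = \<alpha> - midpt N (j - 1)"

definition width_r :: "real \<Rightarrow> nat \<Rightarrow> nat \<Rightarrow> real" where
  "width_r \<alpha> N j = midpt N (j + 1) - \<alpha>"

text \<open>\<open>ju\<close> and \<open>jf\<close> stand for the jumps of \<open>u\<close> and of the flux.\<close>

definition corr_l :: "real \<Rightarrow> real \<Rightarrow> real \<Rightarrow> real \<Rightarrow> real \<Rightarrow> nat \<Rightarrow> nat \<Rightarrow> real" where
  "corr_l \<alpha> \<beta>m \<beta>p ju jf N j =
     beta_bar \<alpha> \<beta>m \<beta>p N j / (width_l \<alpha> N j * mesh N) * (ju + jf / \<beta>p * (grid N (j + 1) - \<alpha>))"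

definition corr_r :: "real \<Rightarrow> real \<Rightarrow> real \<Rightarrow> real \<Rightarrow> real \<Rightarrow> nat \<Rightarrow> nat \<Rightarrow> real" where
  "corr_r \<alpha> \<beta>m \<beta>p ju jf N j =
     - (beta_bar \<alpha> \<beta>m \<beta>p N j / (width_r \<alpha> N j * mesh N)) * (ju + jf / \<beta>m * (grid N j - \<alpha>))"

text \<open>\<open>ul\<close> and \<open>ur\<close> are the prescribed boundary values.  The predicate is meant for
  \<open>1 \<le> j\<close> and \<open>j + 2 \<le> N\<close>, which holds for \<open>0 < \<alpha> < 1\<close> and large \<open>N\<close>.\<close>

definition harmonic_average_scheme ::
  "real \<Rightarrow> (real \<Rightarrow> real) \<Rightarrow> real \<Rightarrow> real \<Rightarrow> (real \<Rightarrow> real) \<Rightarrow> (real \<Rightarrow> real) \<Rightarrow> real \<Rightarrow> real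
     \<Rightarrow> real \<Rightarrow> real \<Rightarrow> nat \<Rightarrow> nat \<Rightarrow> (nat \<Rightarrow> real) \<Rightarrow> bool" where
  "harmonic_average_scheme \<alpha> \<beta> \<beta>m \<beta>p \<sigma> f v w ul ur N j U \<longleftrightarrow>
     (let h = mesh N; x = grid N; xm = midpt N;
          bb = beta_bar \<alpha> \<beta>m \<beta>p N j;
          ju = 2 * w / (\<beta>m + \<beta>p)
      in U 0 = ul \<and> U N = ur \<and>
         (\<forall>i\<in>{1..N - 1} - {j, j + 1}.
            1 / h\<^sup>2 * (\<beta> (xm i) * (U (i + 1) - U i) - \<beta> (xm (i - 1)) * (U i - U (i - 1)))
              - \<sigma> (x i) * U i = f (x i)) \<and>
         1 / width_l \<alpha> N j *
             (bb * (U (j + 1) - U j) / h - \<beta> (xm (j - 1)) * (U j - U (j - 1)) / h)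
           - \<sigma> (x j) * U j = f (x j) + corr_l \<alpha> \<beta>m \<beta>p ju v N j \<and>
         1 / width_r \<alpha> N j *
             (\<beta> (xm (j + 1)) * (U (j + 2) - U (j + 1)) / h - bb * (U (j + 1) - U j) / h)
           - \<sigma> (x (j + 1)) * U (j + 1) = f (x (j + 1)) + corr_r \<alpha> \<beta>m \<beta>p ju v N j)"

text \<open>If \<open>\<alpha>\<close> is a grid point, the left limit of \<open>u\<close> is the value compared with the scheme.\<close>

definition grid_value :: "real \<Rightarrow> (real \<Rightarrow> real) \<Rightarrow> nat \<Rightarrow> nat \<Rightarrow> real" where
  "grid_value \<alpha> u N i = (if grid N i = \<alpha> then Lim (at_left \<alpha>) u else u (grid N i))"

definition error_norm :: "real \<Rightarrow> (real \<Rightarrow> real) \<Rightarrow> nat \<Rightarrow> (nat \<Rightarrow> real) \<Rightarrow> real" where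
  "error_norm \<alpha> u N U = Max ((\<lambda>i. \<bar>grid_value \<alpha> u N i - U i\<bar>) ` {1..N - 1})"

end

(* The error e = u - U satisfies e (k + 1) - e k = d k + \<theta> k, where a k * d k is h times the
   difference of the exact and the numerical flux at the k-th cell face and \<theta> k is O(h^3),
   but O(h^2) at the face containing the interface, so that \<theta> is O(h^2) in total.  The
   correction terms turn the common difference quotient into one-sided fluxes at the interface
   which differ by exactly v.  Differencing a k * d k therefore leaves the local flux balance of
   a cell, with remainder O(h^4), but O(h^3) next to the interface.  A discrete maximum principle
   bounds e: the barrier has as fluxes the sums of the remainders over the later cells, and the
   two larger remainders do not spoil the total O(h^3).  Only a lower bound for a is used, never
   a modulus of continuity of \<beta>. *)

theory Submission
  imports Defs
begin

subsection \<open>Stability of the discrete operator\<close>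

text \<open>At the first index where a negative minimum is attained, the backward difference is
  strictly negative, the forward one nonnegative, and \<open>- s k * w k\<close> nonnegative, so
  that the row would be positive.\<close>

lemma discrete_minimum_principle:
  fixes a s w :: "nat \<Rightarrow> real"
  assumes a: "\<And>k. k < N \<Longrightarrow> 0 < a k"
    and s: "\<And>i. 1 \<le> i \<Longrightarrow> i < N \<Longrightarrow> 0 \<le> s i"
    and w: "\<And>i. 1 \<le> i \<Longrightarrow> i < N \<Longrightarrow>
      a i * (w (i + 1) - w i) - a (i - 1) * (w i - w (i - 1)) - s i * w i \<le> 0"
    and bnd: "0 \<le> w 0" "0 \<le> w N"
    and i: "i \<le> N"
  shows "0 \<le> w i"
proof (rule ccontr)
  assume neg: "\<not> 0 \<le> w i"
  define m where "m = Min (w ` {..N})"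
  have m_le: "m \<le> w k" if "k \<le> N" for k
    unfolding m_def using that by (intro Min_le) auto
  have "m \<in> w ` {..N}"
    unfolding m_def by (intro Min_in) auto
  then have ex: "\<exists>k. k \<le> N \<and> w k = m"
    by auto
  \<comment> \<open>Taking the least minimiser makes the backward difference strict; strictness
    cannot come from \<open>s\<close>, which may vanish.\<close>
  define k where "k = (LEAST k. k \<le> N \<and> w k = m)"
  have k: "k \<le> N" "w k = m"
    using LeastI_ex[OF ex] by (auto simp: k_def)
  have m_neg: "m < 0"
    using m_le[OF i] neg by simp
  have k_int: "1 \<le> k" "k < N"
    using k m_neg bnd by (cases k; force simp: le_less)+
  have "k - 1 < k"
    using k_int by simp
  from not_less_Least[OF this[unfolded k_def]] have "w (k - 1) \<noteq> m"
    using k by (simp add: k_def)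
  moreover have "m \<le> w (k - 1)"
    using k by (intro m_le) simp
  ultimately have "m < w (k - 1)"
    by simp
  then have "a (k - 1) * (w k - w (k - 1)) < 0"
    using a[of "k - 1"] k k_int by (intro mult_pos_neg) auto
  moreover have "0 \<le> a k * (w (k + 1) - w k)"
    using a[of k] m_le[of "k + 1"] k k_int by (intro mult_nonneg_nonneg) auto
  moreover have "s k * w k \<le> 0"
    using s[of k] m_neg k k_int by (intro mult_nonneg_nonpos) auto
  ultimately show False
    using w[OF k_int] by linarith
qed

text \<open>Since the flux of the barrier drops by exactly \<open>r i\<close> across row
  \<open>i\<close>, the minimum principle applies to \<open>B + \<phi> - z\<close>. Each of the at
  most \<open>N\<close> increments of \<open>\<phi>\<close> is at most the total remainder divided
  by \<open>a0\<close>.\<close>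

lemma discrete_upper_bound:
  fixes a s z r :: "nat \<Rightarrow> real"
  assumes a0: "0 < a0" and a: "\<And>k. k < N \<Longrightarrow> a0 \<le> a k"
    and s: "\<And>i. 1 \<le> i \<Longrightarrow> i < N \<Longrightarrow> 0 \<le> s i"
    and z: "\<And>i. 1 \<le> i \<Longrightarrow> i < N \<Longrightarrow>
      - r i \<le> a i * (z (i + 1) - z i) - a (i - 1) * (z i - z (i - 1)) - s i * z i"
    and r: "\<And>i. 0 \<le> r i"
    and bnd: "z 0 \<le> B" "z N \<le> B" "0 \<le> B"
    and i: "i \<le> N"
  shows "z i \<le> B + real N / a0 * (\<Sum>i=1..<N. r i)"
proof -
  define P where "P k = (\<Sum>i=k+1..<N. r i)" for k
  define \<phi> where "\<phi> i = (\<Sum>k<i. P k / a k)" for i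
  have P_nonneg: "0 \<le> P k" for k
    unfolding P_def using r by (intro sum_nonneg)
  have P_le: "P k \<le> P 0" for k
    unfolding P_def using r by (intro sum_mono2) auto
  have P_diff: "P (i - 1) = r i + P i" if "1 \<le> i" "i < N" for i
    unfolding P_def using that by (simp add: sum.atLeast_Suc_lessThan)
  have a_pos: "0 < a k" if "k < N" for k
    using a[OF that] a0 by linarith
  have \<phi>_diff: "a k * (\<phi> (k + 1) - \<phi> k) = P k" if "k < N" for k
    unfolding \<phi>_def using a_pos[OF that] by simp
  have \<phi>_nonneg: "0 \<le> \<phi> i" if "i \<le> N" for i
    unfolding \<phi>_def using that P_nonneg a_pos
    by (intro sum_nonneg divide_nonneg_pos) auto
  have "\<phi> i \<le> (\<Sum>k<i. P 0 / a0)"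
    unfolding \<phi>_def
  proof (rule sum_mono)
    fix k assume "k \<in> {..<i}"
    with i have "k < N" by simp
    then show "P k / a k \<le> P 0 / a0"
      using P_le[of k] P_nonneg[of 0] a[of k] a0 by (intro frac_le) auto
  qed
  also have "\<dots> = real i * (P 0 / a0)"
    by simp
  also have "\<dots> \<le> real N * (P 0 / a0)"
    using i P_nonneg[of 0] a0 by (intro mult_right_mono) auto
  finally have \<phi>_le: "\<phi> i \<le> real N / a0 * (\<Sum>i=1..<N. r i)"
    by (simp add: P_def)
  have "0 \<le> B + \<phi> i - z i"
  proof (rule discrete_minimum_principle[of N a s "\<lambda>i. B + \<phi> i - z i"])
    fix k assume k: "1 \<le> k" "k < N"
    have 1: "a (k - 1) * (\<phi> k - \<phi> (k - 1)) = P (k - 1)"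
      using \<phi>_diff[of "k - 1"] k by simp
    \<comment> \<open>The barrier is nonnegative, so its zero-order term has the favourable
      sign.\<close>
    have 2: "0 \<le> s k * (B + \<phi> k)"
      using s k bnd \<phi>_nonneg[of k] by simp
    show "a k * (B + \<phi> (k + 1) - z (k + 1) - (B + \<phi> k - z k))
        - a (k - 1) * (B + \<phi> k - z k - (B + \<phi> (k - 1) - z (k - 1)))
        - s k * (B + \<phi> k - z k) \<le> 0"
      using \<phi>_diff[of k] 1 2 P_diff[of k] z[of k] k
      by (simp add: algebra_simps)
  qed (use a_pos s bnd i \<phi>_nonneg[of N] in \<open>auto simp: \<phi>_def\<close>)
  with \<phi>_le show ?thesis
    by linarith
qed

lemma discrete_stability:
  fixes a s z r :: "nat \<Rightarrow> real"
  assumes a0: "0 < a0" and a: "\<And>k. k < N \<Longrightarrow> a0 \<le> a k"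
    and s: "\<And>i. 1 \<le> i \<Longrightarrow> i < N \<Longrightarrow> 0 \<le> s i"
    and z: "\<And>i. 1 \<le> i \<Longrightarrow> i < N \<Longrightarrow>
      \<bar>a i * (z (i + 1) - z i) - a (i - 1) * (z i - z (i - 1)) - s i * z i\<bar> \<le> r i"
    and r: "\<And>i. 0 \<le> r i"
    and bnd: "\<bar>z 0\<bar> \<le> B" "\<bar>z N\<bar> \<le> B"
    and i: "i \<le> N"
  shows "\<bar>z i\<bar> \<le> B + real N / a0 * (\<Sum>i=1..<N. r i)"
proof -
  have "z i \<le> B + real N / a0 * (\<Sum>i=1..<N. r i)"
  proof (rule discrete_upper_bound[OF a0 a s _ r])
    fix k assume "1 \<le> k" "k < N"
    from z[OF this] show "- r k \<le> a k * (z (k + 1) - z k)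
        - a (k - 1) * (z k - z (k - 1)) - s k * z k"
      by (simp add: abs_le_iff)
  qed (use bnd i in auto)
  moreover have "- z i \<le> B + real N / a0 * (\<Sum>i=1..<N. r i)"
  proof (rule discrete_upper_bound[OF a0 a s _ r, where z = "\<lambda>i. - z i"])
    fix k assume "1 \<le> k" "k < N"
    from z[OF this] show "- r k \<le> a k * (- z (k + 1) - - z k)
        - a (k - 1) * (- z k - - z (k - 1)) - s k * - z k"
      by (simp add: algebra_simps abs_le_iff)
  qed (use bnd i in auto)
  ultimately show ?thesis
    by simp
qed

text \<open>The perturbation \<open>\<theta>\<close> of the differences is summed up and subtracted; no
  differences of \<open>a * \<theta>\<close> occur, so that no smoothness of \<open>a\<close> is involved.\<close>

lemma perturbed_stability:
  fixes a s e d \<theta> r :: "nat \<Rightarrow> real"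
  assumes a0: "0 < a0" and a: "\<And>k. k < N \<Longrightarrow> a0 \<le> a k"
    and s: "\<And>i. 1 \<le> i \<Longrightarrow> i < N \<Longrightarrow> 0 \<le> s i \<and> s i \<le> S"
    and d: "\<And>k. k < N \<Longrightarrow> e (k + 1) - e k = d k + \<theta> k"
    and row: "\<And>i. 1 \<le> i \<Longrightarrow> i < N \<Longrightarrow>
      \<bar>a i * d i - a (i - 1) * d (i - 1) - s i * e i\<bar> \<le> r i"
    and r: "\<And>i. 0 \<le> r i"
    and S: "0 \<le> S"
    and T: "(\<Sum>k<N. \<bar>\<theta> k\<bar>) \<le> T"
    and bnd: "e 0 = 0" "e N = 0"
    and i: "i \<le> N"
  shows "\<bar>e i\<bar> \<le> 2 * T + real N / a0 * ((\<Sum>i=1..<N. r i) + real N * (S * T))"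
proof -
  \<comment> \<open>\<open>\<eta>\<close> is the discrete primitive of \<open>\<theta>\<close>, so
    the differences of \<open>z\<close> are exactly \<open>d\<close>.\<close>
  define \<eta> where "\<eta> i = (\<Sum>k<i. \<theta> k)" for i
  define z where "z i = e i - \<eta> i" for i
  have \<eta>_le: "\<bar>\<eta> i\<bar> \<le> T" if "i \<le> N" for i
  proof -
    have "\<bar>\<eta> i\<bar> \<le> (\<Sum>k<i. \<bar>\<theta> k\<bar>)"
      unfolding \<eta>_def by (rule sum_abs)
    also have "\<dots> \<le> (\<Sum>k<N. \<bar>\<theta> k\<bar>)"
      using that by (intro sum_mono2) auto
    finally show ?thesis
      using T by linarith
  qed
  have T0: "0 \<le> T"
    using \<eta>_le[of 0] by simp
  have z_diff: "z (k + 1) - z k = d k" if "k < N" for k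
    using d[OF that] by (simp add: z_def \<eta>_def)
  \<comment> \<open>Passing from \<open>e\<close> to \<open>z\<close> costs
    \<open>s i * \<eta> i\<close>, hence the extra \<open>S * T\<close> in each row. The right end
    value of \<open>z\<close> is \<open>- \<eta> N\<close>, hence the boundary bound
    \<open>T\<close>; adding \<open>\<eta>\<close> back at the end costs a second
    \<open>T\<close>.\<close>
  have "\<bar>z i\<bar> \<le> T + real N / a0 * (\<Sum>i=1..<N. r i + S * T)"
  proof (rule discrete_stability[of a0 N a s z "\<lambda>i. r i + S * T"])
    fix i assume i: "1 \<le> i" "i < N"
    have 1: "z i - z (i - 1) = d (i - 1)"
      using z_diff[of "i - 1"] i by simp
    have "\<bar>s i * \<eta> i\<bar> \<le> S * T"
      using s[of i] \<eta>_le[of i] i S by (auto simp: abs_mult intro!: mult_mono)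
    then show "\<bar>a i * (z (i + 1) - z i) - a (i - 1) * (z i - z (i - 1)) - s i * z i\<bar>
        \<le> r i + S * T"
      using row[OF i] i unfolding 1 z_diff[OF i(2)] by (simp add: z_def algebra_simps)
  next
    show "\<bar>z 0\<bar> \<le> T" "\<bar>z N\<bar> \<le> T"
      using bnd \<eta>_le[of N] T0 by (auto simp: z_def \<eta>_def)
  qed (use a0 a s r S T0 i in auto)
  also have "\<dots> \<le> T + real N / a0 * ((\<Sum>i=1..<N. r i) + real N * (S * T))"
    using a0 S T0 by (intro add_left_mono mult_left_mono) (auto simp: sum.distrib intro!: mult_right_mono)
  finally show ?thesis
    using \<eta>_le[OF i] by (simp add: z_def)
qed

subsection \<open>Expansions on the two subintervals\<close>

text \<open>These two estimates are what the grid argument keeps of \<open>C^3\<close> regularity.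
  The one-point estimate serves next to the interface; the centred one, a power better because the
  quadratic terms cancel, serves everywhere else.\<close>

definition expands :: "real \<Rightarrow> real set \<Rightarrow> (real \<Rightarrow> real) \<Rightarrow> (real \<Rightarrow> real) \<Rightarrow> bool" where
  "expands K S g g' \<longleftrightarrow>
     (\<forall>x\<in>S. \<forall>y\<in>S. \<bar>g y - g x - g' x * (y - x)\<bar> \<le> K * (y - x)\<^sup>2) \<and>
     (\<forall>x t. x \<in> S \<longrightarrow> x - t \<in> S \<longrightarrow> x + t \<in> S \<longrightarrow>
        \<bar>g (x + t) - g (x - t) - 2 * t * g' x\<bar> \<le> K * \<bar>t\<bar> ^ 3)"

lemma expands_mono:
  assumes "expands K S g g'" "K \<le> K'"
  shows "expands K' S g g'"
  using assms unfolding expands_def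
  by (meson mult_right_mono order_trans zero_le_power2 zero_le_power abs_ge_zero)

lemma Ck_on_mono:
  assumes "Ck_on k S g" "m < k"
  shows "Ck_on m S g"
proof -
  obtain D :: "nat \<Rightarrow> real \<Rightarrow> real" where "\<forall>x\<in>S. D 0 x = g x"
    and D: "\<forall>m<k. \<forall>x\<in>S. (D m has_real_derivative D (Suc m) x) (at x within S)"
    using assms(1) unfolding Ck_on_def by blast
  moreover from D \<open>m < k\<close> have "continuous_on S (D m)"
    unfolding continuous_on_eq_continuous_within by (meson DERIV_continuous)
  ultimately show ?thesis
    unfolding Ck_on_def using \<open>m < k\<close> by (intro exI[of _ D]) auto
qed

text \<open>Compactness bounds the second and third derivatives. The centred estimate is the
  difference of two second-order Taylor expansions about \<open>x\<close>, in which the terms with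
  \<open>D 2\<close> agree.\<close>

lemma Ck_on_3_expands:
  fixes a b :: real
  assumes ab: "a < b" and g: "Ck_on 3 {a..b} g"
  obtains g' K where "expands K {a..b} g g'" "continuous_on {a..b} g'"
    "\<And>x. x \<in> {a..b} \<Longrightarrow> (g has_real_derivative g' x) (at x within {a..b})"
proof -
  obtain D :: "nat \<Rightarrow> real \<Rightarrow> real" where D0: "\<And>x. x \<in> {a..b} \<Longrightarrow> D 0 x = g x"
    and D: "\<And>m x. m < 3 \<Longrightarrow> x \<in> {a..b} \<Longrightarrow>
      (D m has_real_derivative D (Suc m) x) (at x within {a..b})"
    and D3: "continuous_on {a..b} (D 3)"
    using g unfolding Ck_on_def by blast
  have cont: "continuous_on {a..b} (D m)" if "m \<le> 3" for m
  proof (cases "m = 3")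
    case False
    with D[of m] that show ?thesis
      unfolding continuous_on_eq_continuous_within by (meson DERIV_continuous le_neq_implies_less)
  qed (use D3 in simp)
  have bd: "\<exists>B. \<forall>x\<in>{a..b}. \<bar>D m x\<bar> \<le> B" if "m \<le> 3" for m
    using compact_imp_bounded[OF compact_continuous_image[OF cont[OF that] compact_Icc]]
    by (auto simp: bounded_iff)
  obtain B2 where B2: "\<And>x. x \<in> {a..b} \<Longrightarrow> \<bar>D 2 x\<bar> \<le> B2"
    using bd[of 2] by (auto simp del: atLeastAtMost_iff)
  obtain B3 where B3: "\<And>x. x \<in> {a..b} \<Longrightarrow> \<bar>D 3 x\<bar> \<le> B3"
    using bd[of 3] by (auto simp del: atLeastAtMost_iff)
  have nonneg: "0 \<le> B2" "0 \<le> B3"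
    using B2[of a] B3[of a] ab by auto
  have T1: "\<bar>g y - (g x + D 1 x * (y - x))\<bar> \<le> B2 * \<bar>y - x\<bar> ^ 2" if "x \<in> {a..b}" "y \<in> {a..b}" for x y
    using field_Taylor[of "{a..b}" 1 D B2 x y] D B2 that
    by (simp add: D0 numeral_2_eq_2)
  have T2: "\<bar>g y - (g x + D 1 x * (y - x) + D 2 x * (y - x)\<^sup>2 / 2)\<bar> \<le> B3 * \<bar>y - x\<bar> ^ 3"
    if "x \<in> {a..b}" "y \<in> {a..b}" for x y
  proof -
    have "norm (D 0 y - (\<Sum>i\<le>2. D i x * (y - x) ^ i / fact i)) \<le> B3 * norm (y - x) ^ (Suc 2) / fact 2"
      by (rule field_Taylor[of "{a..b}" 2 D B3]) (use D B3 that in \<open>auto simp: numeral_3_eq_3\<close>)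
    moreover have "B3 * t ^ (Suc 2) / fact 2 \<le> B3 * t ^ 3" if "0 \<le> t" for t
      using nonneg that mult_nonneg_nonneg[of B3 "t ^ 3"] by (simp add: eval_nat_numeral)
    from this[of "norm (y - x)"]
    have "B3 * norm (y - x) ^ (Suc 2) / fact 2 \<le> B3 * \<bar>y - x\<bar> ^ 3"
      by simp
    ultimately show ?thesis
      using that by (simp add: D0 numeral_2_eq_2)
  qed
  have "expands (B2 + 2 * B3) {a..b} g (D 1)"
    unfolding expands_def
  proof (intro conjI ballI allI impI)
    fix x y assume "x \<in> {a..b}" "y \<in> {a..b}"
    from T1[OF this] have "\<bar>g y - g x - D 1 x * (y - x)\<bar> \<le> B2 * (y - x)\<^sup>2"
      by (simp add: algebra_simps)
    also have "\<dots> \<le> (B2 + 2 * B3) * (y - x)\<^sup>2"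
      using nonneg by (intro mult_right_mono) auto
    finally show "\<bar>g y - g x - D 1 x * (y - x)\<bar> \<le> (B2 + 2 * B3) * (y - x)\<^sup>2" .
  next
    fix x t assume *: "x \<in> {a..b}" "x - t \<in> {a..b}" "x + t \<in> {a..b}"
    have "\<bar>g (x + t) - g (x - t) - 2 * t * D 1 x\<bar> \<le> (2 * B3) * \<bar>t\<bar> ^ 3"
      using T2[OF *(1,2)] T2[OF *(1,3)] by (simp add: algebra_simps abs_if split: if_splits)
    also have "\<dots> \<le> (B2 + 2 * B3) * \<bar>t\<bar> ^ 3"
      using nonneg by (intro mult_right_mono) auto
    finally show "\<bar>g (x + t) - g (x - t) - 2 * t * D 1 x\<bar> \<le> (B2 + 2 * B3) * \<bar>t\<bar> ^ 3" .
  qed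
  moreover have "(g has_real_derivative D 1 x) (at x within {a..b})" if "x \<in> {a..b}" for x
    using D[of 0 x] that D0 by (auto intro: has_field_derivative_transform_within[of "D 0" _ _ _ 1])
  ultimately show thesis
    using cont[of 1] by (intro that[of "B2 + 2 * B3" "D 1"]) auto
qed

section \<open>One-sided limits, and the equation up to the end points\<close>

lemma tendsto_at_left_extension:
  fixes g ge :: "real \<Rightarrow> real"
  assumes "a < b" "continuous_on {a..b} ge" "\<And>x. x \<in> {a<..<b} \<Longrightarrow> ge x = g x"
  shows "(g \<longlongrightarrow> ge b) (at_left b)"
proof (rule Lim_transform_eventually)
  show "(ge \<longlongrightarrow> ge b) (at_left b)"
    using assms by (intro continuous_on_Icc_at_leftD)
  show "\<forall>\<^sub>F x in at_left b. ge x = g x"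
    using assms by (intro eventually_at_leftI[of a]) auto
qed

lemma tendsto_at_right_extension:
  fixes g ge :: "real \<Rightarrow> real"
  assumes "a < b" "continuous_on {a..b} ge" "\<And>x. x \<in> {a<..<b} \<Longrightarrow> ge x = g x"
  shows "(g \<longlongrightarrow> ge a) (at_right a)"
proof (rule Lim_transform_eventually)
  show "(ge \<longlongrightarrow> ge a) (at_right a)"
    using assms by (intro continuous_on_Icc_at_rightD)
  show "\<forall>\<^sub>F x in at_right a. ge x = g x"
    using assms by (intro eventually_at_rightI[of _ b]) auto
qed

text \<open>Passing to extensions makes the equation available at the end points, which matters
  because the interface may be a grid point. The relation between flux and derivative stays on the
  open interval, since nothing ties the values of \<open>\<beta>\<close> at the end points to its
  limits.\<close>

lemma subinterval_expansion:
  fixes a b :: real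
  assumes ab: "a < b"
    and ue: "Ck_on 4 {a..b} ue" "\<And>x. x \<in> {a<..<b} \<Longrightarrow> ue x = u x"
    and fe: "Ck_on 3 {a..b} fe" "\<And>x. x \<in> {a<..<b} \<Longrightarrow> fe x = flux \<beta> u x"
    and \<sigma>: "continuous_on {a..b} \<sigma>" and f: "continuous_on {a..b} f"
    and ode: "\<And>x. x \<in> {a<..<b} \<Longrightarrow> deriv (flux \<beta> u) x - \<sigma> x * u x = f x"
  obtains u' f' K where "0 \<le> K" "expands K {a..b} ue u'" "expands K {a..b} fe f'"
    "continuous_on {a..b} ue" "continuous_on {a..b} u'" "continuous_on {a..b} fe"
    "\<And>x. x \<in> {a<..<b} \<Longrightarrow> fe x = \<beta> x * u' x"
    "\<And>x. x \<in> {a..b} \<Longrightarrow> f' x = \<sigma> x * ue x + f x"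
proof -
  have "Ck_on 3 {a..b} ue"
    using ue(1) by (rule Ck_on_mono) simp
  then obtain u' Ku where u': "expands Ku {a..b} ue u'" "continuous_on {a..b} u'"
    and du: "\<And>x. x \<in> {a..b} \<Longrightarrow> (ue has_real_derivative u' x) (at x within {a..b})"
    using Ck_on_3_expands[OF ab] by blast
  obtain f' Kf where f': "expands Kf {a..b} fe f'" "continuous_on {a..b} f'"
    and df: "\<And>x. x \<in> {a..b} \<Longrightarrow> (fe has_real_derivative f' x) (at x within {a..b})"
    using Ck_on_3_expands[OF ab fe(1)] by blast
  have cont: "continuous_on {a..b} ue" "continuous_on {a..b} fe"
    using DERIV_continuous_on[OF du] DERIV_continuous_on[OF df] by auto
  \<comment> \<open>\<open>flux\<close> is built from \<open>deriv u\<close>, not from the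
    derivative of the extension; near an interior point both functions agree on an open set, so
    their derivatives agree.\<close>
  have deriv_eq: "deriv g x = g' x"
    if "\<And>x. x \<in> {a..b} \<Longrightarrow> (ge has_real_derivative g' x) (at x within {a..b})"
      and "\<And>x. x \<in> {a<..<b} \<Longrightarrow> ge x = g x" and x: "x \<in> {a<..<b}" for g ge g' :: "real \<Rightarrow> real" and x
  proof -
    have "(ge has_real_derivative g' x) (at x)"
      using that(1)[of x] x by (simp add: at_within_Icc_at)
    then have "(g has_real_derivative g' x) (at x)"
      by (rule has_field_derivative_transform_within_open[OF _ open_greaterThanLessThan x]) (rule that(2))
    then show ?thesis
      by (rule DERIV_imp_deriv)
  qed
  \<comment> \<open>The residual is continuous on the closed interval and vanishes on its dense
    interior.\<close>
  have "f' x - (\<sigma> x * ue x + f x) = 0" if "x \<in> {a..b}" for x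
  proof (rule continuous_constant_on_closure[of "{a<..<b}"
          "\<lambda>x. f' x - (\<sigma> x * ue x + f x)"])
    show "continuous_on (closure {a<..<b}) (\<lambda>x. f' x - (\<sigma> x * ue x + f x))"
      using ab cont f' \<sigma> f by (auto intro!: continuous_intros)
    show "f' y - (\<sigma> y * ue y + f y) = 0" if "y \<in> {a<..<b}" for y
      using ode[OF that] deriv_eq[OF df fe(2) that] ue(2)[OF that] by simp
  qed (use ab that in auto)
  moreover have "fe x = \<beta> x * u' x" if "x \<in> {a<..<b}" for x
    using deriv_eq[OF du ue(2) that] fe(2)[OF that] by (simp add: flux_def)
  moreover have "expands (max 0 (max Ku Kf)) {a..b} ue u'" "expands (max 0 (max Ku Kf)) {a..b} fe f'"
    using u'(1) f'(1) by (auto elim: expands_mono)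
  ultimately show thesis
    using cont u'(2) by (intro that[of "max 0 (max Ku Kf)" u' f']) auto
qed

subsection \<open>Consistency on a grid\<close>

text \<open>One grid is fixed here, while \<open>K\<close>, \<open>M\<close> and
  \<open>\<beta>0\<close> are to be instantiated independently of it, which makes the final constant
  uniform in \<open>h\<close>. \<open>ul\<close> and \<open>ur\<close> stand for the extensions of
  the solution from the two sides, \<open>fl\<close> and \<open>fr\<close> for those of its
  flux.\<close>

locale interface_grid =
  fixes \<alpha> \<beta>0 \<beta>m \<beta>p v ju K M :: real and \<beta> \<sigma> f ul ul' fl fl' ur ur' fr fr' :: "real \<Rightarrow> real"
    and N j :: nat
  assumes \<beta>0: "0 < \<beta>0"
    and \<beta>: "\<And>x. x \<in> {0<..<\<alpha>} \<union> {\<alpha><..<1} \<Longrightarrow> \<beta>0 \<le> \<beta> x" "\<beta>0 \<le> \<beta>m" "\<beta>0 \<le> \<beta>p"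
    and expands_l: "expands K {0..\<alpha>} ul ul'" "expands K {0..\<alpha>} fl fl'"
    and expands_r: "expands K {\<alpha>..1} ur ur'" "expands K {\<alpha>..1} fr fr'"
    and flux_l: "\<And>x. x \<in> {0<..<\<alpha>} \<Longrightarrow> fl x = \<beta> x * ul' x" "fl \<alpha> = \<beta>m * ul' \<alpha>"
    and flux_r: "\<And>x. x \<in> {\<alpha><..<1} \<Longrightarrow> fr x = \<beta> x * ur' x" "fr \<alpha> = \<beta>p * ur' \<alpha>"
    and ode_l: "\<And>x. x \<in> {0..\<alpha>} \<Longrightarrow> fl' x = \<sigma> x * ul x + f x"
    and ode_r: "\<And>x. x \<in> {\<alpha>..1} \<Longrightarrow> fr' x = \<sigma> x * ur x + f x"
    and ju: "ju = ur \<alpha> - ul \<alpha>" and v: "v = fr \<alpha> - fl \<alpha>"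
    and \<sigma>: "\<And>x. x \<in> {0..1} \<Longrightarrow> 0 \<le> \<sigma> x \<and> \<sigma> x \<le> M"
    and K: "0 \<le> K"
    and j: "left_irregular \<alpha> N j" "1 \<le> j" "j + 2 \<le> N"
begin

section \<open>Exact nodal values, face fluxes and cells\<close>

definition h where "h = mesh N"
definition bb where "bb = beta_bar \<alpha> \<beta>m \<beta>p N j"
text \<open>Node \<open>j\<close> takes the left extension even if it lies on the interface, in
  accordance with \<open>grid_value\<close>.\<close>

definition exact where "exact i = (if i \<le> j then ul (grid N i) else ur (grid N i))"
definition coeff where "coeff k = (if k = j then bb else \<beta> (midpt N k))"
text \<open>Face \<open>j\<close> is moved to the interface itself and carries the left limit of the
  flux; the jump \<open>v\<close> is then charged to cell \<open>j + 1\<close>.\<close>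

definition exflux where
  "exflux k = (if k < j then fl (midpt N k) else if k = j then fl \<alpha> else fr (midpt N k))"
text \<open>This is the bracket in \<open>corr_l\<close>; the one in \<open>corr_r\<close> equals
  \<open>corr - v * (h / bb)\<close>, so a single correction suffices.\<close>

definition corr where "corr = ju + v / \<beta>p * (grid N (j + 1) - \<alpha>)"
definition width where
  "width i = (if i = j then width_l \<alpha> N j else if i = j + 1 then width_r \<alpha> N j else h)"
text \<open>The same expression with \<open>U\<close> and \<open>numflux\<close> in place of
  \<open>exact\<close> and \<open>exflux\<close> vanishes, so this is the truncation error at a
  face.\<close>

definition \<theta> where
  "\<theta> k = exact (k + 1) - exact k - h * exflux k / coeff k - (if k = j then corr else 0)"

section \<open>Positions of nodes and faces, and bounds on the coefficients\<close>

lemma h: "0 < h" "real N * h = 1"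
  using j by (auto simp: h_def mesh_def)

lemma grid_eq: "grid N i = real i * h"
  by (simp add: grid_def h_def)

lemma midpt_eq: "midpt N i = real i * h + h / 2"
  by (simp add: midpt_def grid_def h_def)

lemma midpt_pred: "1 \<le> i \<Longrightarrow> midpt N (i - 1) = real i * h - h / 2"
  by (simp add: midpt_eq of_nat_diff algebra_simps)

lemma alpha_bounds: "real j * h \<le> \<alpha>" "\<alpha> < real j * h + h"
  using j by (auto simp: left_irregular_def grid_eq algebra_simps)

lemma mult_h_mono: "i \<le> k \<Longrightarrow> real i * h \<le> real k * h"
  using h by (intro mult_right_mono) auto

lemma mult_h_Suc_le: "i < k \<Longrightarrow> real i * h + h \<le> real k * h"
  using mult_h_mono[of "i + 1" k] by (simp add: algebra_simps)

lemma grid_mem: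
  "i \<le> j \<Longrightarrow> grid N i \<in> {0..\<alpha>}"
  "j < i \<Longrightarrow> i \<le> N \<Longrightarrow> grid N i \<in> {\<alpha>..1}"
  "i \<le> N \<Longrightarrow> grid N i \<in> {0..1}"
  using order_trans[OF mult_h_mono[of i j] alpha_bounds(1)] mult_h_Suc_le[of j i]
    mult_h_mono[of i N] alpha_bounds(2) h
  by (auto simp: grid_eq)

lemma midpt_mem:
  "k < j \<Longrightarrow> midpt N k \<in> {0<..<\<alpha>}"
  "j < k \<Longrightarrow> k < N \<Longrightarrow> midpt N k \<in> {\<alpha><..<1}"
  using mult_h_Suc_le[of k j] mult_h_Suc_le[of j k] mult_h_Suc_le[of k N] alpha_bounds h
  by (auto simp: midpt_eq add_nonneg_pos intro: le_less_trans less_le_trans)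

lemma alpha_mem: "\<alpha> \<in> {0..\<alpha>}" "\<alpha> \<in> {\<alpha>..1}"
  using grid_mem(1)[of j] grid_mem(2)[of "j + 1"] j by auto

lemma width_bounds: "0 < width i" "width i \<le> 2 * h"
  using alpha_bounds h j
  by (auto simp: width_def width_l_def width_r_def midpt_pred midpt_eq algebra_simps)

text \<open>\<open>h / bb\<close> is the total resistance of two segments in series, with
  conductivities \<open>\<beta>m\<close> and \<open>\<beta>p\<close>.\<close>

lemma inverse_bb: "h / bb = (grid N (j + 1) - \<alpha>) / \<beta>p + (\<alpha> - grid N j) / \<beta>m"
  using h \<beta>0 \<beta> unfolding bb_def beta_bar_def h_def[symmetric]
  by (simp add: field_simps)

text \<open>At the interface each of the two resistances is at most its length over
  \<open>\<beta>0\<close>, and the lengths add up to \<open>h\<close>. At the other faces the lower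
  bound of \<open>\<beta>\<close> applies directly.\<close>

lemma coeff_ge:
  assumes "k < N"
  shows "\<beta>0 \<le> coeff k"
proof (cases "k = j")
  case True
  have "h / bb \<le> (grid N (j + 1) - \<alpha>) / \<beta>0 + (\<alpha> - grid N j) / \<beta>0"
    unfolding inverse_bb using \<beta> \<beta>0 alpha_bounds
    by (intro add_mono divide_left_mono) (auto simp: grid_eq algebra_simps)
  also have "\<dots> = h / \<beta>0"
    using \<beta>0 by (simp add: grid_eq field_simps)
  finally have le: "h / bb \<le> h / \<beta>0" .
  have "0 < h / bb"
  proof (cases "\<alpha> = grid N j")
    case True
    then show ?thesis
      unfolding inverse_bb using \<beta> \<beta>0 h by (simp add: grid_eq algebra_simps)
  next
    case False
    then show ?thesis
      unfolding inverse_bb using \<beta> \<beta>0 alpha_bounds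
      by (intro add_nonneg_pos divide_nonneg_pos divide_pos_pos) (auto simp: grid_eq algebra_simps)
  qed
  then have "0 < bb"
    using h by (simp add: zero_less_divide_iff)
  then show ?thesis
    using le h \<beta>0 True by (simp add: coeff_def divide_simps split: if_splits)
next
  case False
  then show ?thesis
    using \<beta>(1)[of "midpt N k"] midpt_mem[of k] assms by (cases "k < j") (auto simp: coeff_def)
qed

lemma coeff_pos: "k < N \<Longrightarrow> 0 < coeff k"
  using coeff_ge[of k] \<beta>0 by simp

section \<open>Truncation error at the faces\<close>

lemma expands_point:
  "expands K S g g' \<Longrightarrow> x \<in> S \<Longrightarrow> y \<in> S \<Longrightarrow> \<bar>g y - g x - g' x * (y - x)\<bar> \<le> K * (y - x)\<^sup>2"
  by (auto simp: expands_def)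

lemma expands_centered:
  assumes "expands K S g g'" "x \<in> S" "x - h / 2 \<in> S" "x + h / 2 \<in> S"
  shows "\<bar>g (x + h / 2) - g (x - h / 2) - h * g' x\<bar> \<le> K * h ^ 3"
proof -
  have "\<bar>g (x + h / 2) - g (x - h / 2) - 2 * (h / 2) * g' x\<bar> \<le> K * \<bar>h / 2\<bar> ^ 3"
    using assms unfolding expands_def by blast
  also have "\<dots> \<le> K * h ^ 3"
    using K h by (intro mult_left_mono power_mono) auto
  finally show ?thesis
    by simp
qed

lemma square_le: "\<bar>t\<bar> \<le> h \<Longrightarrow> K * t\<^sup>2 \<le> K * h\<^sup>2"
  using K by (intro mult_left_mono) (auto simp: abs_le_square_iff[symmetric])

text \<open>Off the interface the value of \<open>\<beta>\<close> at the midpoint cancels in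
  \<open>exflux k / coeff k\<close>, leaving the derivative of the solution there, so a centred
  difference remains.\<close>

lemma theta_regular:
  assumes k: "k < N" "k \<noteq> j"
  shows "\<bar>\<theta> k\<bar> \<le> K * h ^ 3"
proof -
  have grid: "midpt N k - h / 2 = grid N k" "midpt N k + h / 2 = grid N (k + 1)"
    by (simp_all add: midpt_eq grid_eq algebra_simps)
  show ?thesis
  proof (cases "k < j")
    case True
    then have "exflux k / coeff k = ul' (midpt N k)"
      using coeff_pos[of k] flux_l(1)[OF midpt_mem(1)[OF True]] k by (simp add: exflux_def coeff_def)
    then have "\<theta> k = ul (grid N (k + 1)) - ul (grid N k) - h * ul' (midpt N k)"
      using True by (simp add: \<theta>_def exact_def flip: times_divide_eq_right)
    then show ?thesis
      using expands_centered[OF expands_l(1), of "midpt N k"] midpt_mem(1)[OF True] True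
        grid_mem(1)[of k] grid_mem(1)[of "k + 1"] unfolding grid by auto
  next
    case False
    with k have jk: "j < k" by simp
    then have "exflux k / coeff k = ur' (midpt N k)"
      using coeff_pos[of k] flux_r(1)[OF midpt_mem(2)[OF jk]] k by (simp add: exflux_def coeff_def)
    then have "\<theta> k = ur (grid N (k + 1)) - ur (grid N k) - h * ur' (midpt N k)"
      using jk by (simp add: \<theta>_def exact_def flip: times_divide_eq_right)
    then show ?thesis
      using expands_centered[OF expands_r(1), of "midpt N k"] midpt_mem(2)[OF jk] jk k
        grid_mem(2)[of k] grid_mem(2)[of "k + 1"] unfolding grid by auto
  qed
qed

text \<open>By \<open>inverse_bb\<close> the left flux splits into slopes on the two segments.
  Together with the jumps in \<open>corr\<close> these form exactly the linear Taylor polynomials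
  about \<alpha> on both sides, and only their two quadratic remainders are left.\<close>

lemma theta_irregular: "\<bar>\<theta> j\<bar> \<le> 2 * K * h\<^sup>2"
proof -
  define p where "p = grid N (j + 1) - \<alpha>"
  define q where "q = grid N j - \<alpha>"
  have pq: "\<bar>p\<bar> \<le> h" "\<bar>q\<bar> \<le> h"
    using alpha_bounds by (auto simp: p_def q_def grid_eq algebra_simps)
  have pos: "\<beta>p > 0" "\<beta>m > 0"
    using \<beta> \<beta>0 by auto
  have "h * exflux j / coeff j = (h / bb) * fl \<alpha>"
    by (simp add: exflux_def coeff_def)
  also have "\<dots> = p / \<beta>p * fl \<alpha> - q * ul' \<alpha>"
    unfolding inverse_bb p_def[symmetric] using pos flux_l(2) by (simp add: q_def field_simps)
  also have "p / \<beta>p * fl \<alpha> = p * (fl \<alpha> / \<beta>p)"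
    by simp
  \<comment> \<open>The left flux is expressed by the right slope; the resulting multiple of
    \<open>v / \<beta>p\<close> is what the flux part of \<open>corr\<close> cancels.\<close>
  also have "fl \<alpha> / \<beta>p = ur' \<alpha> - v / \<beta>p"
    using pos flux_r(2) v by (simp add: field_simps)
  finally have "\<theta> j = (ur (grid N (j + 1)) - ur \<alpha> - ur' \<alpha> * p) - (ul (grid N j) - ul \<alpha> - ul' \<alpha> * q)"
    using ju by (simp add: \<theta>_def exact_def corr_def p_def algebra_simps)
  moreover have "\<bar>ur (grid N (j + 1)) - ur \<alpha> - ur' \<alpha> * p\<bar> \<le> K * h\<^sup>2"
    using expands_point[OF expands_r(1) alpha_mem(2) grid_mem(2)[of "j + 1"]] square_le[OF pq(1)] j
    by (simp add: p_def)
  moreover have "\<bar>ul (grid N j) - ul \<alpha> - ul' \<alpha> * q\<bar> \<le> K * h\<^sup>2"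
    using expands_point[OF expands_l(1) alpha_mem(1) grid_mem(1)[of j]] square_le[OF pq(2)]
    by (simp add: q_def)
  ultimately show ?thesis
    by linarith
qed

section \<open>Flux balance of the exact solution\<close>

lemma flux_balance_regular:
  assumes i: "1 \<le> i" "i < N" "i \<noteq> j" "i \<noteq> j + 1"
  shows "\<bar>exflux i - exflux (i - 1) - h * (\<sigma> (grid N i) * exact i + f (grid N i))\<bar> \<le> K * h ^ 3"
proof -
  have mid: "grid N i - h / 2 = midpt N (i - 1)" "grid N i + h / 2 = midpt N i"
    using i by (simp_all add: midpt_eq midpt_pred grid_eq algebra_simps)
  show ?thesis
  proof (cases "i < j")
    case True
    have mem: "grid N i \<in> {0..\<alpha>}" "midpt N (i - 1) \<in> {0..\<alpha>}" "midpt N i \<in> {0..\<alpha>}"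
      using grid_mem(1)[of i] midpt_mem(1)[of "i - 1"] midpt_mem(1)[of i] True less_imp_diff_less[of i j 1]
      by auto
    have "\<bar>fl (midpt N i) - fl (midpt N (i - 1)) - h * fl' (grid N i)\<bar> \<le> K * h ^ 3"
      using expands_centered[OF expands_l(2), of "grid N i"] mem by (simp add: mid)
    moreover have "exflux i = fl (midpt N i)" "exflux (i - 1) = fl (midpt N (i - 1))"
      "exact i = ul (grid N i)"
      using True by (auto simp: exflux_def exact_def)
    ultimately show ?thesis
      using ode_l[OF mem(1)] by simp
  next
    case False
    with i have ji: "j + 1 < i" by simp
    have mem: "grid N i \<in> {\<alpha>..1}" "midpt N (i - 1) \<in> {\<alpha>..1}" "midpt N i \<in> {\<alpha>..1}"
      using grid_mem(2)[of i] midpt_mem(2)[of "i - 1"] midpt_mem(2)[of i] ji i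
        less_diff_conv[of j i 1] less_imp_diff_less[of i N 1] by auto
    have "\<bar>fr (midpt N i) - fr (midpt N (i - 1)) - h * fr' (grid N i)\<bar> \<le> K * h ^ 3"
      using expands_centered[OF expands_r(2), of "grid N i"] mem by (simp add: mid)
    moreover have "exflux i = fr (midpt N i)" "exflux (i - 1) = fr (midpt N (i - 1))"
      "exact i = ur (grid N i)"
      using ji by (auto simp: exflux_def exact_def)
    ultimately show ?thesis
      using ode_r[OF mem(1)] by simp
  qed
qed

text \<open>Meant for cells whose node \<open>x\<close> is off centre: two expansions about
  \<open>x\<close> are subtracted, with no gain from symmetry.\<close>

lemma expands_two_points:
  assumes g: "expands K S g g'" and S: "x \<in> S" "y \<in> S" "z \<in> S"
    and "\<bar>y - x\<bar> \<le> h" "\<bar>z - x\<bar> \<le> h"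
  shows "\<bar>g y - g z - (y - z) * g' x\<bar> \<le> 2 * K * h\<^sup>2"
proof -
  have "g y - g z - (y - z) * g' x = (g y - g x - g' x * (y - x)) - (g z - g x - g' x * (z - x))"
    by (simp add: algebra_simps)
  then show ?thesis
    using expands_point[OF g S(1,2)] expands_point[OF g S(1,3)] square_le[OF assms(5)] square_le[OF assms(6)]
    by linarith
qed

text \<open>The cell reaches from \<open>midpt N (j - 1)\<close> to \<alpha>, so its node is in
  general off centre, but within \<open>h\<close> of both ends.\<close>

lemma flux_balance_left:
  "\<bar>exflux j - exflux (j - 1) - width j * (\<sigma> (grid N j) * exact j + f (grid N j))\<bar> \<le> 2 * K * h\<^sup>2"
proof -
  have mem: "grid N j \<in> {0..\<alpha>}" "midpt N (j - 1) \<in> {0..\<alpha>}"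
    using grid_mem(1)[of j] midpt_mem(1)[of "j - 1"] j by auto
  have "\<bar>fl \<alpha> - fl (midpt N (j - 1)) - (\<alpha> - midpt N (j - 1)) * fl' (grid N j)\<bar> \<le> 2 * K * h\<^sup>2"
    by (rule expands_two_points[OF expands_l(2) mem(1) alpha_mem(1) mem(2)])
      (use alpha_bounds h in \<open>auto simp only: midpt_pred[OF j(2)] grid_eq abs_le_iff\<close>)
  then show ?thesis
    using ode_l[OF mem(1)] j by (simp add: exflux_def exact_def width_def width_l_def)
qed

text \<open>The cell begins at \<alpha> with the right limit of the flux, which is
  \<open>exflux j + v\<close>.\<close>

lemma flux_balance_right:
  "\<bar>exflux (j + 1) - exflux j - v
     - width (j + 1) * (\<sigma> (grid N (j + 1)) * exact (j + 1) + f (grid N (j + 1)))\<bar> \<le> 2 * K * h\<^sup>2"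
proof -
  have mem: "grid N (j + 1) \<in> {\<alpha>..1}" "midpt N (j + 1) \<in> {\<alpha>..1}"
    using grid_mem(2)[of "j + 1"] midpt_mem(2)[of "j + 1"] j by auto
  have "\<bar>fr (midpt N (j + 1)) - fr \<alpha> - (midpt N (j + 1) - \<alpha>) * fr' (grid N (j + 1))\<bar> \<le> 2 * K * h\<^sup>2"
    by (rule expands_two_points[OF expands_r(2) mem(1) mem(2) alpha_mem(2)])
      (use alpha_bounds h in \<open>auto simp: midpt_eq grid_eq algebra_simps\<close>)
  then show ?thesis
    using ode_r[OF mem(1)] v by (simp add: exflux_def exact_def width_def width_r_def)
qed

lemma flux_balance:
  assumes i: "1 \<le> i" "i < N"
  shows "\<bar>exflux i - exflux (i - 1) - (if i = j + 1 then v else 0)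
     - width i * (\<sigma> (grid N i) * exact i + f (grid N i))\<bar>
     \<le> K * h ^ 3 + (if i = j \<or> i = j + 1 then 2 * K * h\<^sup>2 else 0)"
proof -
  have nonneg: "0 \<le> K * h ^ 3"
    using K h by simp
  consider "i = j" | "i = j + 1" | "i \<noteq> j" "i \<noteq> j + 1" by blast
  then show ?thesis
  proof cases
    case 1
    then show ?thesis
      using flux_balance_left nonneg by simp
  next
    case 2
    then show ?thesis
      using flux_balance_right nonneg by simp
  next
    case 3
    then show ?thesis
      using flux_balance_regular[OF i 3] by (simp add: width_def)
  qed
qed

section \<open>Numerical fluxes and the error bound\<close>

context
  fixes U :: "nat \<Rightarrow> real" and w :: real
  assumes scheme: "harmonic_average_scheme \<alpha> \<beta> \<beta>m \<beta>p \<sigma> f v w (exact 0) (exact N) N j U"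
    and w: "ju = 2 * w / (\<beta>m + \<beta>p)"
begin

text \<open>The correction sits inside the difference, so that face \<open>j\<close> has a single
  flux for both neighbouring cells, the counterpart of the left limit in
  \<open>exflux\<close>.\<close>

definition numflux where
  "numflux k = coeff k * (U (k + 1) - U k - (if k = j then corr else 0)) / h"

lemma scheme_rows:
  shows "U 0 = exact 0" "U N = exact N"
    and "i \<in> {1..N - 1} - {j, j + 1} \<Longrightarrow>
      1 / h\<^sup>2 * (\<beta> (midpt N i) * (U (i + 1) - U i) - \<beta> (midpt N (i - 1)) * (U i - U (i - 1)))
        - \<sigma> (grid N i) * U i = f (grid N i)"
    and "1 / width j * (bb * (U (j + 1) - U j) / h - \<beta> (midpt N (j - 1)) * (U j - U (j - 1)) / h)
        - \<sigma> (grid N j) * U j = f (grid N j) + bb / (width j * h) * corr"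
    and "1 / width (j + 1) *
        (\<beta> (midpt N (j + 1)) * (U (j + 2) - U (j + 1)) / h - bb * (U (j + 1) - U j) / h)
        - \<sigma> (grid N (j + 1)) * U (j + 1)
        = f (grid N (j + 1)) - bb / (width (j + 1) * h) * (ju + v / \<beta>m * (grid N j - \<alpha>))"
  using scheme
  by (simp_all add: harmonic_average_scheme_def Let_def corr_l_def corr_r_def w[symmetric] h_def bb_def
      width_def corr_def)

text \<open>Multiplied by the cell length, every row of the scheme becomes the balance of
  \<open>flux_balance\<close> without remainder. In row \<open>j + 1\<close> this rests on the
  relation between the two corrections.\<close>

lemma numflux_balance:
  assumes i: "1 \<le> i" "i < N"
  shows "numflux i - numflux (i - 1) - (if i = j + 1 then v else 0)
    = width i * (\<sigma> (grid N i) * U i + f (grid N i))"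
proof -
  note pos = h(1) width_bounds(1)[of i]
  consider "i = j" | "i = j + 1" | "i \<noteq> j" "i \<noteq> j + 1" by blast
  then show ?thesis
  proof cases
    case 1
    have "\<sigma> (grid N j) * U j + f (grid N j) = 1 / width j *
        (bb * (U (j + 1) - U j) / h - \<beta> (midpt N (j - 1)) * (U j - U (j - 1)) / h) - bb / (width j * h) * corr"
      using scheme_rows(4) by linarith
    then have "width j * (\<sigma> (grid N j) * U j + f (grid N j)) =
        bb * (U (j + 1) - U j) / h - \<beta> (midpt N (j - 1)) * (U j - U (j - 1)) / h - bb / h * corr"
      using pos 1 by (simp add: right_diff_distrib)
    \<comment> \<open>With truncated subtraction, \<open>1 \<le> j\<close> is what keeps the left
      face of cell \<open>j\<close> apart from the interface face.\<close>
    moreover have "j - 1 \<noteq> j"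
      using j by simp
    ultimately show ?thesis
      using 1 j by (simp add: numflux_def coeff_def algebra_simps diff_divide_distrib add_divide_distrib)
  next
    case 2
    have "\<sigma> (grid N (j + 1)) * U (j + 1) + f (grid N (j + 1)) = 1 / width (j + 1) *
        (\<beta> (midpt N (j + 1)) * (U (j + 2) - U (j + 1)) / h - bb * (U (j + 1) - U j) / h)
        + bb / (width (j + 1) * h) * (ju + v / \<beta>m * (grid N j - \<alpha>))"
      using scheme_rows(5) by linarith
    then have "width (j + 1) * (\<sigma> (grid N (j + 1)) * U (j + 1) + f (grid N (j + 1))) =
        \<beta> (midpt N (j + 1)) * (U (j + 2) - U (j + 1)) / h - bb * (U (j + 1) - U j) / h
        + bb / h * (ju + v / \<beta>m * (grid N j - \<alpha>))"
      using pos 2 by (simp add: distrib_left)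
    \<comment> \<open>By \<open>inverse_bb\<close> the brackets of the two corrections differ by
      \<open>v * (h / bb)\<close>; the factor \<open>bb / h\<close> turns this into exactly the flux
      jump \<open>v\<close>.\<close>
    also have "ju + v / \<beta>m * (grid N j - \<alpha>) = corr - v * (h / bb)"
      unfolding inverse_bb corr_def by (simp add: algebra_simps diff_divide_distrib add_divide_distrib)
    also have "bb / h * (corr - v * (h / bb)) = bb / h * corr - v"
      using pos coeff_pos[of j] j by (simp add: coeff_def right_diff_distrib)
    finally show ?thesis
      using 2 by (simp add: numflux_def coeff_def algebra_simps diff_divide_distrib add_divide_distrib)
  next
    case 3
    with i have "i \<in> {1..N - 1} - {j, j + 1}"
      by auto
    from scheme_rows(3)[OF this] have "\<sigma> (grid N i) * U i + f (grid N i) =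
        1 / h\<^sup>2 * (\<beta> (midpt N i) * (U (i + 1) - U i) - \<beta> (midpt N (i - 1)) * (U i - U (i - 1)))"
      by linarith
    then have "h * (\<sigma> (grid N i) * U i + f (grid N i)) =
        \<beta> (midpt N i) * (U (i + 1) - U i) / h - \<beta> (midpt N (i - 1)) * (U i - U (i - 1)) / h"
      using pos by (simp add: power2_eq_square diff_divide_distrib right_diff_distrib)
    moreover have "i - 1 \<noteq> j"
      using i 3 by simp
    ultimately show ?thesis
      using 3 i by (simp add: numflux_def coeff_def width_def)
  qed
qed

lemma error_bound:
  assumes M: "0 \<le> M" and i: "i \<le> N"
  shows "\<bar>exact i - U i\<bar> \<le> (6 * K + (5 * K + 6 * M * K) / \<beta>0) * h\<^sup>2"
proof -
  define e where "e i = exact i - U i" for i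
  define d where "d k = h * (exflux k - numflux k) / coeff k" for k
  \<comment> \<open>The extra factor \<open>h\<close> appears because \<open>coeff k * d k\<close>
    is \<open>h\<close> times a difference of fluxes.\<close>
  define r where "r i = h * (K * h ^ 3 + (if i = j \<or> i = j + 1 then 2 * K * h\<^sup>2 else 0))" for i
  have Nh: "real N * h ^ 3 = h\<^sup>2" "real N * h ^ 4 = h ^ 3"
    using h(2) by (simp_all add: power2_eq_square power3_eq_cube power4_eq_xxxx mult.assoc[symmetric])
  \<comment> \<open>Here \<open>T\<close> is \<open>3 * K * h^2\<close>, and \<open>S\<close> is
    \<open>2 * h^2 * M\<close>, from the factor \<open>h\<close> and the bound \<open>2 * h\<close>
    on the cell length.\<close>
  have "\<bar>e i\<bar> \<le> 2 * (3 * K * h\<^sup>2) +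
      real N / \<beta>0 * ((\<Sum>i=1..<N. r i) + real N * (2 * h\<^sup>2 * M * (3 * K * h\<^sup>2)))"
  proof (rule perturbed_stability[of \<beta>0 N coeff "\<lambda>i. h * (width i * \<sigma> (grid N i))" "2 * h\<^sup>2 * M" e d \<theta> r])
    fix i assume i: "1 \<le> i" "i < N"
    have \<sigma>i: "0 \<le> \<sigma> (grid N i)" "\<sigma> (grid N i) \<le> M"
      using \<sigma> grid_mem(3)[of i] i by auto
    have "width i * \<sigma> (grid N i) \<le> 2 * h * M"
      using \<sigma>i width_bounds[of i] h by (intro mult_mono) auto
    then have "h * (width i * \<sigma> (grid N i)) \<le> h * (2 * h * M)"
      using h by (intro mult_left_mono) auto
    then show "0 \<le> h * (width i * \<sigma> (grid N i)) \<and> h * (width i * \<sigma> (grid N i)) \<le> 2 * h\<^sup>2 * M"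
      using \<sigma>i width_bounds[of i] h by (simp add: power2_eq_square algebra_simps)
    have cd: "coeff k * d k = h * (exflux k - numflux k)" if "k < N" for k
      using coeff_pos[OF that] by (simp add: d_def)
    have "coeff i * d i - coeff (i - 1) * d (i - 1) - h * (width i * \<sigma> (grid N i)) * e i
      = h * (exflux i - exflux (i - 1) - (numflux i - numflux (i - 1)) - width i * \<sigma> (grid N i) * e i)"
      using cd[of i] cd[of "i - 1"] i by (simp add: algebra_simps)
    \<comment> \<open>The numerical balance is substituted; \<open>U\<close> and \<open>e\<close>
      recombine to \<open>exact\<close>, leaving the residual of the exact solution.\<close>
    also have "\<dots> = h * (exflux i - exflux (i - 1) - (if i = j + 1 then v else 0)
        - width i * (\<sigma> (grid N i) * exact i + f (grid N i)))"
      using numflux_balance[OF i] by (simp add: e_def algebra_simps)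
    finally show "\<bar>coeff i * d i - coeff (i - 1) * d (i - 1) - h * (width i * \<sigma> (grid N i)) * e i\<bar> \<le> r i"
      using flux_balance[OF i] h unfolding r_def by (simp only: abs_mult) (intro mult_mono, auto)
  next
    fix k assume "k < N"
    then show "e (k + 1) - e k = d k + \<theta> k"
      using coeff_pos[of k] h by (simp add: e_def d_def \<theta>_def numflux_def field_simps)
  next
    \<comment> \<open>As \<open>N * h = 1\<close>, the cubic parts total \<open>K * h^2\<close>, and
      the interface face adds \<open>2 * K * h^2\<close>.\<close>
    have "(\<Sum>k<N. \<bar>\<theta> k\<bar>) \<le> (\<Sum>k<N. K * h ^ 3 + (if k = j then 2 * K * h\<^sup>2 else 0))"
    proof (rule sum_mono)
      fix k assume "k \<in> {..<N}"
      then show "\<bar>\<theta> k\<bar> \<le> K * h ^ 3 + (if k = j then 2 * K * h\<^sup>2 else 0)"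
        using theta_regular[of k] theta_irregular K h by (cases "k = j") (auto intro: add_increasing)
    qed
    also have "\<dots> = K * (real N * h ^ 3) + 2 * K * h\<^sup>2"
      using j by (simp add: sum.distrib)
    finally show "(\<Sum>k<N. \<bar>\<theta> k\<bar>) \<le> 3 * K * h\<^sup>2"
      by (simp add: Nh)
  next
    show "0 \<le> r k" for k
      using K h by (simp add: r_def)
  qed (use \<beta>0 coeff_ge M i scheme_rows(1,2) in \<open>auto simp: e_def\<close>)
  \<comment> \<open>The regular parts total at most \<open>K * h^3\<close>; each of the two
    interface cells adds \<open>2 * K * h^3\<close>.\<close>
  also have "(\<Sum>i=1..<N. r i) \<le> 5 * K * h ^ 3"
  proof -
    have "(\<Sum>i=1..<N. r i) \<le> (\<Sum>i<N. r i)"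
      using K h by (intro sum_mono2) (auto simp: r_def)
    also have "\<dots> = (\<Sum>i<N. K * h ^ 4 + (if i = j then 2 * K * h ^ 3 else 0)
        + (if i = j + 1 then 2 * K * h ^ 3 else 0))"
      by (intro sum.cong) (auto simp: r_def algebra_simps power2_eq_square power3_eq_cube power4_eq_xxxx)
    also have "\<dots> = K * (real N * h ^ 4) + 4 * K * h ^ 3"
      using j by (simp add: sum.distrib)
    finally show ?thesis
      by (simp add: Nh)
  qed
  \<comment> \<open>One factor \<open>N\<close> lowers \<open>h^3\<close> to \<open>h^2\<close>; the
    two factors \<open>N\<close> at the zero-order term are absorbed by its
    \<open>h^4\<close>.\<close>
  also have "2 * (3 * K * h\<^sup>2) + real N / \<beta>0 * (5 * K * h ^ 3 + real N * (2 * h\<^sup>2 * M * (3 * K * h\<^sup>2)))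
    = 6 * K * h\<^sup>2 + (5 * K * (real N * h ^ 3) + 6 * M * K * ((real N * h)\<^sup>2 * h\<^sup>2)) / \<beta>0"
    using \<beta>0 by (simp add: field_simps power2_eq_square)
  also have "\<dots> = (6 * K + (5 * K + 6 * M * K) / \<beta>0) * h\<^sup>2"
    by (simp add: Nh h(2) algebra_simps add_divide_distrib)
  finally show ?thesis
    using \<beta>0 by (simp add: e_def divide_right_mono mult_left_mono)
qed

end

end

subsection \<open>Convergence\<close>

theorem theorem1:
  fixes \<alpha> \<beta>0 \<beta>m \<beta>p v w :: real
    and \<beta> \<sigma> f u :: "real \<Rightarrow> real"
  assumes "0 < \<alpha>" and "\<alpha> < 1"
    and "\<beta>0 > 0" and "\<And>x. x \<in> {0<..<\<alpha>} \<union> {\<alpha><..<1} \<Longrightarrow> \<beta> x \<ge> \<beta>0"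
    and "continuous_on {0<..<\<alpha>} \<beta>" and "continuous_on {\<alpha><..<1} \<beta>"
    and "(\<beta> \<longlongrightarrow> \<beta>m) (at_left \<alpha>)" and "(\<beta> \<longlongrightarrow> \<beta>p) (at_right \<alpha>)"
    and "continuous_on {0..1} \<sigma>" and "continuous_on {0..1} f"
    and "\<And>x. x \<in> {0..1} \<Longrightarrow> \<sigma> x \<ge> 0"
    and "interface_solution \<alpha> \<beta> \<beta>m \<beta>p \<sigma> f v w u"
    and "piecewise_Ck 4 \<alpha> u"
    and flux_regular: "piecewise_Ck 3 \<alpha> (flux \<beta> u)"
  shows "\<exists>C. \<forall>\<^sub>F N in sequentially. \<forall>j U.
           left_irregular \<alpha> N j \<longrightarrow>
           harmonic_average_scheme \<alpha> \<beta> \<beta>m \<beta>p \<sigma> f v w (u 0) (u 1) N j U \<longrightarrow>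
           error_norm \<alpha> u N U \<le> C * (mesh N)\<^sup>2"
proof -
  note \<alpha> = assms(1,2) and \<beta>0 = assms(3) and \<beta>_ge = assms(4)
    and \<beta>_lim = assms(7,8) and \<sigma>_cont = assms(9) and f_cont = assms(10) and \<sigma>_nonneg = assms(11)
  from assms(12) have u0: "(u \<longlongrightarrow> u 0) (at_right 0)" and u1: "(u \<longlongrightarrow> u 1) (at_left 1)"
    and ode: "\<And>x. x \<in> {0<..<\<alpha>} \<union> {\<alpha><..<1} \<Longrightarrow> deriv (flux \<beta> u) x - \<sigma> x * u x = f x"
    and jump_u: "has_jump u \<alpha> (2 * w / (\<beta>m + \<beta>p))" and jump_flux: "has_jump (flux \<beta> u) \<alpha> v"
    unfolding interface_solution_def by blast+
  from assms(13) obtain ul ur where ul: "Ck_on 4 {0..\<alpha>} ul" "\<And>x. x \<in> {0<..<\<alpha>} \<Longrightarrow> ul x = u x"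
    and ur: "Ck_on 4 {\<alpha>..1} ur" "\<And>x. x \<in> {\<alpha><..<1} \<Longrightarrow> ur x = u x"
    unfolding piecewise_Ck_def by blast
  from flux_regular obtain fl fr
    where fl: "Ck_on 3 {0..\<alpha>} fl" "\<And>x. x \<in> {0<..<\<alpha>} \<Longrightarrow> fl x = flux \<beta> u x"
    and fr: "Ck_on 3 {\<alpha>..1} fr" "\<And>x. x \<in> {\<alpha><..<1} \<Longrightarrow> fr x = flux \<beta> u x"
    unfolding piecewise_Ck_def by blast
  have cont_sub: "continuous_on {0..\<alpha>} \<sigma>" "continuous_on {0..\<alpha>} f"
    "continuous_on {\<alpha>..1} \<sigma>" "continuous_on {\<alpha>..1} f"
    using \<sigma>_cont f_cont \<alpha> by (auto elim: continuous_on_subset)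
  obtain ul' fl' Kl where Kl: "0 \<le> Kl" "expands Kl {0..\<alpha>} ul ul'" "expands Kl {0..\<alpha>} fl fl'"
    and contl: "continuous_on {0..\<alpha>} ul" "continuous_on {0..\<alpha>} ul'" "continuous_on {0..\<alpha>} fl"
    and fluxl: "\<And>x. x \<in> {0<..<\<alpha>} \<Longrightarrow> fl x = \<beta> x * ul' x"
    and odel: "\<And>x. x \<in> {0..\<alpha>} \<Longrightarrow> fl' x = \<sigma> x * ul x + f x"
    by (rule subinterval_expansion[OF \<alpha>(1) ul fl cont_sub(1,2) ode]) auto
  obtain ur' fr' Kr where Kr: "0 \<le> Kr" "expands Kr {\<alpha>..1} ur ur'" "expands Kr {\<alpha>..1} fr fr'"
    and contr: "continuous_on {\<alpha>..1} ur" "continuous_on {\<alpha>..1} ur'" "continuous_on {\<alpha>..1} fr"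
    and fluxr: "\<And>x. x \<in> {\<alpha><..<1} \<Longrightarrow> fr x = \<beta> x * ur' x"
    and oder: "\<And>x. x \<in> {\<alpha>..1} \<Longrightarrow> fr' x = \<sigma> x * ur x + f x"
    by (rule subinterval_expansion[OF \<alpha>(2) ur fr cont_sub(3,4) ode]) auto
  define K where "K = max Kl Kr"
  have K: "0 \<le> K" "expands K {0..\<alpha>} ul ul'" "expands K {0..\<alpha>} fl fl'"
    "expands K {\<alpha>..1} ur ur'" "expands K {\<alpha>..1} fr fr'"
    using Kl Kr by (auto simp: K_def elim: expands_mono)
  have "bounded (\<sigma> ` {0..1})"
    by (intro compact_imp_bounded compact_continuous_image \<sigma>_cont compact_Icc)
  then obtain M where M: "0 < M" "\<And>x. x \<in> {0..1} \<Longrightarrow> \<bar>\<sigma> x\<bar> \<le> M"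
    by (auto simp: bounded_pos simp del: atLeastAtMost_iff)
  have \<beta>m: "\<beta>0 \<le> \<beta>m"
    by (rule tendsto_lowerbound[OF \<beta>_lim(1)])
      (use \<alpha> \<beta>_ge in \<open>auto intro!: eventually_at_leftI[of 0]\<close>)
  have \<beta>p: "\<beta>0 \<le> \<beta>p"
    by (rule tendsto_lowerbound[OF \<beta>_lim(2)])
      (use \<alpha> \<beta>_ge in \<open>auto intro!: eventually_at_rightI[of _ 1]\<close>)
  have u_left: "(u \<longlongrightarrow> ul \<alpha>) (at_left \<alpha>)" and u_right: "(u \<longlongrightarrow> ur \<alpha>) (at_right \<alpha>)"
    by (rule tendsto_at_left_extension[OF \<alpha>(1) contl(1) ul(2)]
        tendsto_at_right_extension[OF \<alpha>(2) contr(1) ur(2)]; assumption)+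
  have flux_left: "(flux \<beta> u \<longlongrightarrow> fl \<alpha>) (at_left \<alpha>)" and flux_right: "(flux \<beta> u \<longlongrightarrow> fr \<alpha>) (at_right \<alpha>)"
    by (rule tendsto_at_left_extension[OF \<alpha>(1) contl(3) fl(2)]
        tendsto_at_right_extension[OF \<alpha>(2) contr(3) fr(2)]; assumption)+
  \<comment> \<open>\<open>piecewise_Ck\<close> ties the extension to \<open>u\<close> only inside
    the interval; the boundary value follows from the one-sided continuity of \<open>u\<close>
    there.\<close>
  have ul0: "ul 0 = u 0"
    by (rule tendsto_unique[OF _ tendsto_at_right_extension[OF \<alpha>(1) contl(1) ul(2)] u0]) auto
  have ur1: "ur 1 = u 1"
    by (rule tendsto_unique[OF _ tendsto_at_left_extension[OF \<alpha>(2) contr(1) ur(2)] u1]) auto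
  \<comment> \<open>The left limit of the flux is computed twice, from its extension and as a
    product of limits.\<close>
  have fl\<alpha>: "fl \<alpha> = \<beta>m * ul' \<alpha>"
  proof (rule tendsto_unique[OF _ tendsto_at_left_extension[OF \<alpha>(1) contl(3)]])
    show "((\<lambda>x. \<beta> x * ul' x) \<longlongrightarrow> \<beta>m * ul' \<alpha>) (at_left \<alpha>)"
      using \<beta>_lim(1) continuous_on_Icc_at_leftD[OF contl(2) \<alpha>(1)] by (rule tendsto_mult)
  qed (use fluxl in auto)
  have fr\<alpha>: "fr \<alpha> = \<beta>p * ur' \<alpha>"
  proof (rule tendsto_unique[OF _ tendsto_at_right_extension[OF \<alpha>(2) contr(3)]])
    show "((\<lambda>x. \<beta> x * ur' x) \<longlongrightarrow> \<beta>p * ur' \<alpha>) (at_right \<alpha>)"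
      using \<beta>_lim(2) continuous_on_Icc_at_rightD[OF contr(2) \<alpha>(2)] by (rule tendsto_mult)
  qed (use fluxr in auto)
  have jump_eq: "J = r - l" if "has_jump g \<alpha> J" "(g \<longlongrightarrow> l) (at_left \<alpha>)" "(g \<longlongrightarrow> r) (at_right \<alpha>)"
    for g :: "real \<Rightarrow> real" and J l r
    using that unfolding has_jump_def
    by (metis tendsto_unique trivial_limit_at_left_real trivial_limit_at_right_real)
  \<comment> \<open>This settles the case that \<alpha> is a grid point, where
    \<open>grid_value\<close> is a left limit.\<close>
  have Lim_u: "Lim (at_left \<alpha>) u = ul \<alpha>"
    using u_left by (intro tendsto_Lim) auto
  define C where "C = 6 * K + (5 * K + 6 * M * K) / \<beta>0"
  \<comment> \<open>The two thresholds on \<open>N\<close> yield \<open>1 \<le> j\<close> and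
    \<open>j + 2 \<le> N\<close>.\<close>
  have bound: "error_norm \<alpha> u N U \<le> C * (mesh N)\<^sup>2"
    if N: "1 / \<alpha> \<le> real N" "2 / (1 - \<alpha>) \<le> real N" and j: "left_irregular \<alpha> N j"
      and scheme: "harmonic_average_scheme \<alpha> \<beta> \<beta>m \<beta>p \<sigma> f v w (u 0) (u 1) N j U" for N j U
  proof -
    have N': "1 \<le> real N * \<alpha>" "2 \<le> real N * (1 - \<alpha>)"
      using N \<alpha> by (auto simp: field_simps)
    then have Npos: "0 < real N"
      using \<alpha> by (cases N) auto
    have jN: "real j \<le> real N * \<alpha>" "real N * \<alpha> < real j + 1"
      using j Npos by (auto simp: left_irregular_def grid_def mesh_def field_simps)
    have "1 \<le> j"
      using jN(2) N'(1) by (cases j) auto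
    moreover have "real (j + 2) \<le> real N"
      using jN(1) N'(2) by (simp add: algebra_simps)
    then have j2: "j + 2 \<le> N"
      by linarith
    ultimately interpret interface_grid \<alpha> \<beta>0 \<beta>m \<beta>p v "2 * w / (\<beta>m + \<beta>p)" K M \<beta> \<sigma> f
      ul ul' fl fl' ur ur' fr fr' N j
      using \<beta>0 \<beta>_ge \<beta>m \<beta>p K fluxl fl\<alpha> fluxr fr\<alpha> odel oder j M(2) \<sigma>_nonneg
        jump_eq[OF jump_u u_left u_right] jump_eq[OF jump_flux flux_left flux_right]
      by unfold_locales (auto simp: abs_le_iff)
    have grid_N: "grid N N = 1"
      using h(2) by (simp add: grid_eq)
    have ends: "exact 0 = u 0" "exact N = u 1"
      using ul0 ur1 j2 grid_N by (auto simp: exact_def grid_def)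
    have exact_eq: "grid_value \<alpha> u N i = exact i" if i: "i \<in> {1..N - 1}" for i
    proof (cases "i \<le> j")
      case True
      then have "0 < grid N i" "grid N i \<le> \<alpha>"
        using grid_mem(1)[of i] i h(1) by (auto simp: grid_eq)
      then show ?thesis
        using True Lim_u ul(2)[of "grid N i"] by (auto simp: grid_value_def exact_def)
    next
      case False
      have "\<alpha> < grid N i"
        using False mult_h_Suc_le[of j i] alpha_bounds(2) by (simp add: grid_eq)
      moreover have "i < N"
        using i by auto
      then have "grid N i < 1"
        using mult_h_Suc_le[of i N] h by (simp add: grid_eq)
      ultimately show ?thesis
        using False ur(2)[of "grid N i"] by (simp add: grid_value_def exact_def)
    qed
    show ?thesis
      unfolding error_norm_def
    proof (rule Max.boundedI)
      fix y assume "y \<in> (\<lambda>i. \<bar>grid_value \<alpha> u N i - U i\<bar>) ` {1..N - 1}"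
      then obtain i where i: "i \<in> {1..N - 1}" and y: "y = \<bar>exact i - U i\<bar>"
        using exact_eq by auto
      have "i \<le> N"
        using i by auto
      have "harmonic_average_scheme \<alpha> \<beta> \<beta>m \<beta>p \<sigma> f v w (exact 0) (exact N) N j U"
        using scheme by (simp only: ends)
      from error_bound[OF this refl less_imp_le[OF M(1)] \<open>i \<le> N\<close>]
      show "y \<le> C * (mesh N)\<^sup>2"
        unfolding y C_def h_def .
    qed (use j2 in auto)
  qed
  have "\<forall>\<^sub>F N in sequentially. 1 / \<alpha> \<le> real N \<and> 2 / (1 - \<alpha>) \<le> real N"
    using filterlim_real_sequentially unfolding filterlim_at_top by (intro eventually_conj) blast+
  then have "\<forall>\<^sub>F N in sequentially. \<forall>j U. left_irregular \<alpha> N j \<longrightarrow>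
      harmonic_average_scheme \<alpha> \<beta> \<beta>m \<beta>p \<sigma> f v w (u 0) (u 1) N j U \<longrightarrow>
      error_norm \<alpha> u N U \<le> C * (mesh N)\<^sup>2"
  proof (rule eventually_mono)
    fix N :: nat
    assume "1 / \<alpha> \<le> real N \<and> 2 / (1 - \<alpha>) \<le> real N"
    with bound[of N] show "\<forall>j U. left_irregular \<alpha> N j \<longrightarrow>
        harmonic_average_scheme \<alpha> \<beta> \<beta>m \<beta>p \<sigma> f v w (u 0) (u 1) N j U \<longrightarrow>
        error_norm \<alpha> u N U \<le> C * (mesh N)\<^sup>2"
      by blast
  qed
  then show ?thesis
    by (rule exI[of _ C])
qed

end
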